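(* Any complex lagrangian surface in $(T^*\mathbb{R}^4,\Omega,K)$ or in $(T^*\mathbb{R}^4,\Omega,\tilde K)$ is a generalized solution of the real Monge-Ampère equation $\operatorname{hess} f=1$ in four variables.
   Context: $T^*\mathbb{R}^4\cong\mathbb{R}^8$ has coordinates $(q,p)=(q_1,\dots,q_4,p_1,\dots,p_4)$ and symplectic form $\Omega=\sum_{j=1}^4 dq_j\wedge dp_j$. Let $$A=\begin{pmatrix} 0 & -1 & 0 & 0 \\ 1 & 0 & 0 & 0 \\ 0 & 0 & 0 & -1 \\ 0 & 0 & 1 & 0 \end{pmatrix},\qquad \tilde A=\begin{pmatrix} 0 & -1 & 0 & 0 \\ 1 & 0 & 0 & 0 \\ 0 & 0 & 0 & 1 \\ 0 & 0 & -1 & 0 \end{pmatrix},$$ and define the constant complex structures (block matrices with respect to the basis $\partial_{q_1},\dots,\partial_{q_4},\partial_{p_1},\dots,\partial_{p_4}$) $$K=\begin{pmatrix} 0 & A \\ A & 0 \end{pmatrix},\qquad \tilde K=\begin{pmatrix} 0 & \tilde A \\ \tilde A & 0 \end{pmatrix}.$$ Corresponding holomorphic coordinates are, for $K$: $z_1=q_1+ip_2$, $u_1=p_1+iq_2$, $z_2=q_3+ip_4$, $u_2=p_3+iq_4$; for $\tilde K$: $z_1=q_1+ip_2$, $u_1=p_1+iq_2$, $z_2=q_3-ip_4$, $u_2=p_3-iq_4$; in each case $\Omega$ is the real part of $dz_1\wedge du_1+dz_2\wedge du_2$. A complex lagrangian surface in $(T^*\mathbb{R}^4,\Omega,\mathbb{J})$,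 with $\mathbb{J}=K$ or $\tilde K$, is a real $4$-dimensional submanifold $L$ with $\Omega|_L=0$ whose tangent spaces are $\mathbb{J}$-invariant. The equation $\operatorname{hess} f=1$ ($\operatorname{hess} f$ being the determinant of the Hessian matrix of $f$) corresponds to the $4$-form $$\omega_{H+}=dp_1\wedge dp_2\wedge dp_3\wedge dp_4-dq_1\wedge dq_2\wedge dq_3\wedge dq_4,$$ and a generalized solution is a lagrangian submanifold $L$ of $(T^*\mathbb{R}^4,\Omega)$ such that $\omega_{H+}|_L=0$. *)

theory Defs
  imports "HOL-Analysis.Analysis"
begin

section \<open>Smooth maps, submanifolds and tangent spaces\<close>

text \<open>Only meant for open sets \<open>S\<close>. In finite dimension, continuity of all directional
  derivatives of order at most \<open>k\<close> is continuity of the derivatives themselves, so this is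
  the usual notion of a \<open>C\<^sup>k\<close> map.\<close>

fun Ck_on :: "nat \<Rightarrow> 'a::euclidean_space set \<Rightarrow> ('a \<Rightarrow> 'b::real_normed_vector) \<Rightarrow> bool" where
  "Ck_on 0 S f \<longleftrightarrow> continuous_on S f"
| "Ck_on (Suc k) S f \<longleftrightarrow>
     (\<exists>f'. (\<forall>x\<in>S. (f has_derivative f' x) (at x)) \<and> (\<forall>v. Ck_on k S (\<lambda>x. f' x v)))"

definition smooth_on :: "'a::euclidean_space set \<Rightarrow> ('a \<Rightarrow> 'b::real_normed_vector) \<Rightarrow> bool" where
  "smooth_on S f \<longleftrightarrow> (\<forall>k. Ck_on k S f)"

text \<open>Embedded smooth submanifolds (without boundary), described by slice charts: near each of
  its points, \<open>M\<close> is straightened by an ambient diffeomorphism \<open>\<Phi>\<close> with inverse \<open>\<Psi>\<close>.\<close>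

definition submanifold :: "nat \<Rightarrow> 'a::euclidean_space set \<Rightarrow> bool" where
  "submanifold n M \<longleftrightarrow>
     (\<forall>x\<in>M. \<exists>U V \<Phi> (\<Psi> :: 'a \<Rightarrow> 'a) S.
        open U \<and> x \<in> U \<and> open V \<and>
        homeomorphism U V \<Phi> \<Psi> \<and> smooth_on U \<Phi> \<and> smooth_on V \<Psi> \<and>
        subspace S \<and> dim S = n \<and> \<Phi> ` (M \<inter> U) = V \<inter> S)"

definition tangent_space :: "'a::euclidean_space set \<Rightarrow> 'a \<Rightarrow> 'a set" where
  "tangent_space M x =
     {v. \<exists>e>0. \<exists>\<gamma> :: real \<Rightarrow> 'a.
        smooth_on {-e<..<e} \<gamma> \<and> \<gamma> ` {-e<..<e} \<subseteq> M \<and> \<gamma> 0 = x \<and>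
        (\<gamma> has_vector_derivative v) (at 0)}"


section \<open>Constant differential forms\<close>

text \<open>A constant form of degree \<open>CARD('k)\<close> is given by its values on families of vectors
  indexed by \<open>'k\<close>. Listing the covectors and the vectors in the same order of \<open>'k\<close>, the
  determinant below does not depend on the order chosen.\<close>

type_synonym ('k, 'a) form = "('k \<Rightarrow> 'a) \<Rightarrow> real"

definition wedge :: "('k::finite \<Rightarrow> 'a \<Rightarrow> real) \<Rightarrow> ('k, 'a) form" where
  "wedge \<alpha> v = det (\<chi> i j. \<alpha> i (v j))"

definition wedge2 :: "('a \<Rightarrow> real) \<Rightarrow> ('a \<Rightarrow> real) \<Rightarrow> (2, 'a) form" where
  "wedge2 \<alpha> \<beta> = wedge (\<lambda>i. if i = 1 then \<alpha> else \<beta>)"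

definition vanishes_on :: "('k, 'a::euclidean_space) form \<Rightarrow> 'a set \<Rightarrow> bool" where
  "vanishes_on \<omega> M \<longleftrightarrow> (\<forall>x\<in>M. \<forall>v. (\<forall>i. v i \<in> tangent_space M x) \<longrightarrow> \<omega> v = 0)"


section \<open>The cotangent bundle of \<open>\<real>\<^sup>4\<close>\<close>

text \<open>Points, and tangent vectors at them, are pairs \<open>(q, p)\<close>.\<close>

type_synonym phase = "(real^4) \<times> (real^4)"

definition dq :: "4 \<Rightarrow> phase \<Rightarrow> real" where
  "dq j v = fst v $ j"

definition dp :: "4 \<Rightarrow> phase \<Rightarrow> real" where
  "dp j v = snd v $ j"

definition Omega :: "(2, phase) form" where
  "Omega v = (\<Sum>j\<in>UNIV. wedge2 (dq j) (dp j) v)"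

definition omega_Hplus :: "(4, phase) form" where
  "omega_Hplus v = wedge dp v - wedge dq v"

definition block_op ::
  "real^4^4 \<Rightarrow> real^4^4 \<Rightarrow> real^4^4 \<Rightarrow> real^4^4 \<Rightarrow> phase \<Rightarrow> phase" where
  "block_op P Q R S = (\<lambda>(q, p). (P *v q + Q *v p, R *v q + S *v p))"

definition A :: "real^4^4" where
  "A = vector [vector [0, -1, 0,  0],
               vector [1,  0, 0,  0],
               vector [0,  0, 0, -1],
               vector [0,  0, 1,  0]]"

definition A_tilde :: "real^4^4" where
  "A_tilde = vector [vector [0, -1,  0, 0],
                     vector [1,  0,  0, 0],
                     vector [0,  0,  0, 1],
                     vector [0,  0, -1, 0]]"

definition K :: "phase \<Rightarrow> phase" where
  "K = block_op 0 A A 0"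

definition K_tilde :: "phase \<Rightarrow> phase" where
  "K_tilde = block_op 0 A_tilde A_tilde 0"


section \<open>Lagrangian submanifolds\<close>

definition lagrangian :: "phase set \<Rightarrow> bool" where
  "lagrangian L \<longleftrightarrow> submanifold 4 L \<and> vanishes_on Omega L"

definition complex_lagrangian_surface :: "(phase \<Rightarrow> phase) \<Rightarrow> phase set \<Rightarrow> bool" where
  "complex_lagrangian_surface J L \<longleftrightarrow>
     submanifold 4 L \<and> vanishes_on Omega L \<and>
     (\<forall>x\<in>L. J ` tangent_space L x \<subseteq> tangent_space L x)"

text \<open>Generalized solutions of the Monge-Ampere equation attached to a \<open>4\<close>-form. The equation
  \<open>hess f = 1\<close> is the one attached to \<^const>\<open>omega_Hplus\<close>; see \<open>omega_Hplus_graph\<close> below.\<close>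

definition generalized_solution :: "(4, phase) form \<Rightarrow> phase set \<Rightarrow> bool" where
  "generalized_solution \<omega> L \<longleftrightarrow> lagrangian L \<and> vanishes_on \<omega> L"


section \<open>Consistency checks\<close>

lemma vector_4 [simp]:
  "(vector [a, b, c, d] :: 'a::zero^4) $ 1 = a"
  "(vector [a, b, c, d] :: 'a::zero^4) $ 2 = b"
  "(vector [a, b, c, d] :: 'a::zero^4) $ 3 = c"
  "(vector [a, b, c, d] :: 'a::zero^4) $ 4 = d"
  unfolding vector_def by auto

lemma Omega_eq:
  "Omega v = (\<Sum>j\<in>UNIV. dq j (v 1) * dp j (v 2) - dp j (v 1) * dq j (v 2))"
  by (simp add: Omega_def wedge2_def wedge_def det_2 algebra_simps)

lemma K_coordinates:
  "K (q, p) =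
     (vector [- p$2, p$1, - p$4, p$3], vector [- q$2, q$1, - q$4, q$3])"
  "K_tilde (q, p) =
     (vector [- p$2, p$1, p$4, - p$3], vector [- q$2, q$1, q$4, - q$3])"
  by (simp_all add: K_def K_tilde_def block_op_def A_def A_tilde_def vec_eq_iff forall_4
      matrix_vector_mult_def sum_4)

lemma K_squared: "K (K v) = - v" "K_tilde (K_tilde v) = - v"
  by (cases v; simp add: K_coordinates vec_eq_iff forall_4)+

text \<open>If \<open>H\<close> is the Hessian matrix of \<open>f\<close> at a point, the vectors below are the coordinate
  basis of the tangent space of the graph of \<open>df\<close> over that point.\<close>

lemma omega_Hplus_graph:
  "omega_Hplus (\<lambda>j. (axis j 1, H *v axis j 1)) = det H - 1"
proof -
  have "(\<chi> i j. dp i (axis j 1, H *v axis j 1)) = H"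
    by (simp add: dp_def vec_eq_iff matrix_vector_mult_basis column_def)
  moreover have "(\<chi> i j. dq i (axis j 1, H *v axis j 1)) = mat 1"
    by (simp add: dq_def vec_eq_iff axis_def mat_def)
  ultimately show ?thesis
    by (simp add: omega_Hplus_def wedge_def)
qed

end

theory Submission
  imports Defs
begin

text \<open>The holomorphic symplectic form is \<open>\<Omega> + i\<Theta>\<close> with
  \<open>\<Theta> = (dq\<^sub>1\<^sub>2 + e dq\<^sub>3\<^sub>4) - (dp\<^sub>1\<^sub>2 + e dp\<^sub>3\<^sub>4)\<close>, where \<open>dq\<^sub>i\<^sub>j = dq\<^sub>i \<and> dq\<^sub>j\<close>,
  \<open>e = 1\<close> for \<open>K\<close> and \<open>e = -1\<close> for \<open>K_tilde\<close>. Up to sign \<open>\<Theta>(u, v) = \<Omega>(Ju, v)\<close>, so \<open>\<Theta>\<close> vanishes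
  on complex lagrangian surfaces. Both terms of \<open>\<omega>\<^sub>H\<^sub>+\<close> are determined by these 2-forms, since
  \<open>(dq\<^sub>1\<^sub>2 + e dq\<^sub>3\<^sub>4)\<^sup>2 = 2e dq\<^sub>1\<^sub>2\<^sub>3\<^sub>4\<close> and likewise for \<open>p\<close>.\<close>

text \<open>Laplace expansion along the first two rows.\<close>

lemma det_4:
  fixes M :: "'a::comm_ring_1^4^4"
  shows "det M =
     (M$1$1 * M$2$2 - M$1$2 * M$2$1) * (M$3$3 * M$4$4 - M$3$4 * M$4$3)
   - (M$1$1 * M$2$3 - M$1$3 * M$2$1) * (M$3$2 * M$4$4 - M$3$4 * M$4$2)
   + (M$1$1 * M$2$4 - M$1$4 * M$2$1) * (M$3$2 * M$4$3 - M$3$3 * M$4$2)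
   + (M$1$2 * M$2$3 - M$1$3 * M$2$2) * (M$3$1 * M$4$4 - M$3$4 * M$4$1)
   - (M$1$2 * M$2$4 - M$1$4 * M$2$2) * (M$3$1 * M$4$3 - M$3$3 * M$4$1)
   + (M$1$3 * M$2$4 - M$1$4 * M$2$3) * (M$3$1 * M$4$2 - M$3$2 * M$4$1)"
proof -
  have f: "finite {2::4, 3, 4}" "1 \<notin> {2::4, 3, 4}" "finite {3::4, 4}" "2 \<notin> {3::4, 4}"
      "finite {4::4}" "3 \<notin> {4::4}"
    by auto
  show ?thesis
    unfolding det_def UNIV_4
    unfolding sum_over_permutations_insert[OF f(1,2)]
    unfolding sum_over_permutations_insert[OF f(3,4)]
    unfolding sum_over_permutations_insert[OF f(5,6)]
    unfolding permutes_sing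
    by (simp add: sign_swap_id permutation_swap_id sign_compose permutation_compose swap_id_eq)
      (simp add: algebra_simps)
qed

text \<open>If row \<open>k\<close> of \<open>M\<close> lists the values of a covector \<open>a\<^sub>k\<close> on vectors \<open>v\<^sub>1, \<dots>, v\<^sub>4\<close>, this is
  the value of \<open>a\<^sub>1 \<and> a\<^sub>2 + e a\<^sub>3 \<and> a\<^sub>4\<close> on \<open>v\<^sub>i, v\<^sub>j\<close>.\<close>

definition minor_form :: "'a::comm_ring_1 \<Rightarrow> 'a^4^4 \<Rightarrow> 4 \<Rightarrow> 4 \<Rightarrow> 'a" where
  "minor_form e M i j =
     M$1$i * M$2$j - M$1$j * M$2$i + e * (M$3$i * M$4$j - M$3$j * M$4$i)"

text \<open>The left side is the Pfaffian of \<open>transpose M ** W ** M\<close>, where W is skew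
  with upper entries 1 at (1,2), \<open>e\<close> at (3,4) and 0 elsewhere; it equals
  \<open>det M\<close> times Pf W.\<close>

lemma minor_form_pfaffian:
  fixes M :: "'a::comm_ring_1^4^4"
  shows "minor_form e M 1 2 * minor_form e M 3 4 - minor_form e M 1 3 * minor_form e M 2 4
           + minor_form e M 1 4 * minor_form e M 2 3 = e * det M"
  unfolding minor_form_def det_4 by (simp add: algebra_simps)

lemma omega_Hplus_eq_0:
  fixes v :: "4 \<Rightarrow> phase"
  assumes "e \<noteq> (0::real)"
    and "\<And>i j. minor_form e (\<chi> k l. dq k (v l)) i j = minor_form e (\<chi> k l. dp k (v l)) i j"
  shows "omega_Hplus v = 0"
proof -
  \<comment> \<open>Both sides are Pfaffians of the same skew matrix.\<close>
  have "e * wedge dp v = e * wedge dq v"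
    unfolding wedge_def minor_form_pfaffian[symmetric] assms(2) ..
  with assms(1) show ?thesis
    by (simp add: omega_Hplus_def)
qed

text \<open>\<open>K\<close> swaps q and p through the skew matrix \<open>A\<close>, so pairing with
  \<open>Omega\<close> leaves the 2-form of \<open>A\<close> on the p parts minus that on the q
  parts.\<close>

lemma Omega_K:
  "Omega (\<lambda>k. if k = 1 then K (v i) else v j) =
     minor_form 1 (\<chi> k l. dp k (v l)) i j - minor_form 1 (\<chi> k l. dq k (v l)) i j"
  by (cases "v i") (simp add: Omega_eq minor_form_def K_coordinates dq_def dp_def sum_4 algebra_simps)

text \<open>The second block of \<open>A_tilde\<close> is minus that of \<open>A\<close>, whence
  \<open>e = -1\<close>.\<close>

lemma Omega_K_tilde:
  "Omega (\<lambda>k. if k = 1 then K_tilde (v i) else v j) =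
     minor_form (-1) (\<chi> k l. dp k (v l)) i j - minor_form (-1) (\<chi> k l. dq k (v l)) i j"
  by (cases "v i") (simp add: Omega_eq minor_form_def K_coordinates dq_def dp_def sum_4 algebra_simps)

lemma complex_lagrangian_surface_Omega_eq_0:
  assumes "complex_lagrangian_surface J L" "x \<in> L"
    and "u \<in> tangent_space L x" "w \<in> tangent_space L x"
  shows "Omega (\<lambda>k. if k = 1 then J u else w) = 0"
  using assms unfolding complex_lagrangian_surface_def vanishes_on_def
  by (smt (verit) image_subset_iff)

theorem proposition4:
  fixes L :: "phase set"
  assumes "complex_lagrangian_surface K L \<or> complex_lagrangian_surface K_tilde L"
  shows "generalized_solution omega_Hplus L"
proof -
  have "omega_Hplus v = 0" if x: "x \<in> L" and v: "\<forall>i. v i \<in> tangent_space L x" for x v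
    using assms
  proof
    assume "complex_lagrangian_surface K L"
    then have "Omega (\<lambda>k. if k = 1 then K (v i) else v j) = 0" for i j
      using complex_lagrangian_surface_Omega_eq_0 x v by blast
    then show ?thesis
      by (intro omega_Hplus_eq_0[of 1]) (simp_all add: Omega_K)
  next
    assume "complex_lagrangian_surface K_tilde L"
    then have "Omega (\<lambda>k. if k = 1 then K_tilde (v i) else v j) = 0" for i j
      using complex_lagrangian_surface_Omega_eq_0 x v by blast
    then show ?thesis
      by (intro omega_Hplus_eq_0[of "-1"]) (simp_all add: Omega_K_tilde)
  qed
  then show ?thesis
    using assms
    by (auto simp: generalized_solution_def lagrangian_def complex_lagrangian_surface_def
        vanishes_on_def)
qed

end
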